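(* The space $(\Delta(L^1(S^1),\star_c),\tau^* )$ is homeomorphic to $\mathbb{N}_0=\{0,1,2,\ldots\}$ (with the discrete topology).
   Context: The circle group $S^1$ is identified with $\mathbb{R}/\mathbb{Z}$ (written additively) with its normalized Haar measure, so that $\int_{S^1}f=\int_0^1f(x)\,dx$; $L^1(S^1)$ is the space of complex-valued integrable functions on $S^1$ (modulo a.e. equality). The cosine convolution of $f,g\in L^1(S^1)$ is $$f\star_c g(x) := \int_{S^1} f(y)\cdot\frac{g(x+y)+g(x-y)}{2}\,dy,$$ which is finite for almost every $x$ and makes $L^1(S^1)$ a (not necessarily commutative) Banach algebra. $\Delta(L^1(S^1),\star_c)$ denotes the set of all nonzero continuous $\mathbb{C}$-linear maps $m:L^1(S^1)\to\mathbb{C}$ which are multiplicative: $m(f\star_c g)=m(f)m(g)$ for all $f,g\in L^1(S^1)$. $\tau^*$ is the weak* topology on it (as a subset of the dual of $L^1(S^1)$). *)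

theory Defs
  imports "HOL-Analysis.Analysis"
begin

section \<open>The circle group\<close>

quotient_type circle = real / "\<lambda>x y. x - y \<in> \<int>"
proof (rule equivpI)
  show "reflp (\<lambda>x y::real. x - y \<in> \<int>)"
    by (rule reflpI) simp
  show "symp (\<lambda>x y::real. x - y \<in> \<int>)"
    by (rule sympI) (metis Ints_minus minus_diff_eq)
  show "transp (\<lambda>x y::real. x - y \<in> \<int>)"
    by (rule transpI) (metis Ints_add diff_add_cancel add_diff_eq)
qed

instantiation circle :: ab_group_add
begin

lift_definition zero_circle :: circle is 0 .

lift_definition plus_circle :: "circle \<Rightarrow> circle \<Rightarrow> circle" is "(+)"
  by (metis Ints_add add_diff_add)

lift_definition minus_circle :: "circle \<Rightarrow> circle \<Rightarrow> circle" is "(-)"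
  by (metis Ints_diff diff_diff_eq add_diff_eq diff_add_eq add.commute)

lift_definition uminus_circle :: "circle \<Rightarrow> circle" is uminus
  by (metis Ints_minus minus_diff_minus)

instance
  by standard (transfer; simp)+

end

instantiation circle :: topological_space
begin

definition open_circle :: "circle set \<Rightarrow> bool" where
  "open_circle U \<longleftrightarrow> open (abs_circle -` U)"

instance
  by standard (auto simp: open_circle_def vimage_Union)

end

text \<open>Haar measure is the image of Lebesgue measure on \<open>[0,1)\<close>, so that the integral of \<open>f\<close> is
  the integral of \<open>f \<circ> abs_circle\<close> over \<open>[0,1)\<close>.\<close>

definition haar :: "circle measure" where
  "haar = distr (restrict_space lborel {0..<1}) borel abs_circle"

lift_definition circle_rep :: "circle \<Rightarrow> real" is frac
  by (metis Ints_cases add.commute diff_add_cancel frac_add_of_int_right)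

lemma abs_circle_rep [simp]: "abs_circle (circle_rep x) = x"
  by transfer (simp add: frac_def)

lemma circle_rep_abs: "circle_rep (abs_circle x) = frac x"
  by (simp add: circle_rep.abs_eq)

lemma circle_rep_range: "0 \<le> circle_rep x" "circle_rep x < 1"
  by (transfer; simp add: frac_lt_1)+

lemma abs_circle_eq_iff: "abs_circle x = abs_circle y \<longleftrightarrow> x - y \<in> \<int>"
  by (rule circle.abs_eq_iff)

lemma continuous_abs_circle: "continuous_on UNIV abs_circle"
  by (simp add: continuous_on_open_vimage open_circle_def)

lemma measurable_abs_circle [measurable]: "abs_circle \<in> borel_measurable borel"
  by (rule borel_measurable_continuous_onI[OF continuous_abs_circle])

lemma open_abs_circle_image:
  assumes "open U" shows "open (abs_circle ` U)"
proof -
  have "abs_circle -` abs_circle ` U = (\<Union>k::int. (+) (of_int k) ` U)"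
  proof (intro equalityI subsetI)
    fix x assume "x \<in> abs_circle -` abs_circle ` U"
    then obtain y where y: "y \<in> U" "x - y \<in> \<int>"
      by (auto simp: abs_circle_eq_iff)
    then obtain k where "x - y = of_int k" by (auto elim: Ints_cases)
    then have "x = of_int k + y" by simp
    with y show "x \<in> (\<Union>k::int. (+) (of_int k) ` U)" by blast
  next
    fix x assume "x \<in> (\<Union>k::int. (+) (of_int k) ` U)"
    then obtain k y where "y \<in> U" "x = of_int k + y" by blast
    then show "x \<in> abs_circle -` abs_circle ` U"
      by (auto simp: abs_circle_eq_iff intro!: image_eqI[of _ _ y])
  qed
  then show ?thesis
    using assms by (auto simp: open_circle_def intro!: open_translation)
qed

lemma measurable_circle_rep [measurable]: "circle_rep \<in> borel_measurable borel"
proof (rule borel_measurableI_less)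
  fix a :: real
  have eq: "{x. circle_rep x < a} =
      (if a \<le> 0 then {} else if a > 1 then UNIV else insert 0 (abs_circle ` {0<..<a}))"
  proof (cases "0 < a \<and> a \<le> 1")
    case True
    have "x \<in> insert 0 (abs_circle ` {0<..<a})" if "circle_rep x < a" for x
    proof (cases "circle_rep x = 0")
      case True
      then have "x = 0" by (metis abs_circle_rep zero_circle_def)
      then show ?thesis by simp
    next
      case False
      then show ?thesis
        using that circle_rep_range(1)[of x] abs_circle_rep[of x]
        by (metis greaterThanLessThan_iff image_eqI insertCI order_le_less)
    qed
    moreover have "circle_rep x < a" if "x \<in> insert 0 (abs_circle ` {0<..<a})" for x
      using that
    proof
      assume "x = 0"
      then have "circle_rep x = 0" by transfer simp
      with True show ?thesis by simp
    next
      assume "x \<in> abs_circle ` {0<..<a}"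
      then obtain y where "x = abs_circle y" "0 < y" "y < a" by auto
      with True show ?thesis by (simp add: circle_rep_abs)
    qed
    ultimately have "{x. circle_rep x < a} = insert 0 (abs_circle ` {0<..<a})"
      by blast
    with True show ?thesis by simp
  next
    case False
    then consider "a \<le> 0" | "0 < a" "1 < a" by linarith
    then show ?thesis
    proof cases
      case 1
      have "\<not> circle_rep x < a" for x
        using circle_rep_range(1)[of x] 1 by linarith
      with 1 show ?thesis by simp
    next
      case 2
      have "circle_rep x < a" for x
        using circle_rep_range(2)[of x] 2 by linarith
      with 2 show ?thesis by simp
    qed
  qed
  have sing: "{0::circle} \<in> sets borel"
  proof -
    have "abs_circle -` (- {0}) = - \<int>"
      by (auto simp: zero_circle_def abs_circle_eq_iff)
    then have "open (- {0::circle})"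
      by (simp add: open_circle_def open_Compl)
    then show ?thesis by (intro borel_closed) (simp add: closed_def)
  qed
  have "abs_circle ` {0<..<a} \<in> sets borel"
    by (intro borel_open open_abs_circle_image open_greaterThanLessThan)
  with sing have "insert 0 (abs_circle ` {0<..<a}) \<in> sets borel"
    by (rule sets.insert_in_sets)
  then have "{x. circle_rep x < a} \<in> sets borel"
    unfolding eq by (simp split: if_split)
  then show "{x \<in> space borel. circle_rep x < a} \<in> sets borel"
    by simp
qed

lemma space_haar [simp]: "space haar = UNIV"
  and sets_haar [measurable_cong, simp]: "sets haar = sets borel"
  by (simp_all add: haar_def)

lemma measurable_plus_circle [measurable (raw)]:
  fixes f g :: "'a \<Rightarrow> circle"
  assumes [measurable]: "f \<in> borel_measurable M" "g \<in> borel_measurable M"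
  shows "(\<lambda>x. f x + g x) \<in> borel_measurable M"
proof -
  have eq: "(\<lambda>x. f x + g x) = (\<lambda>x. abs_circle (circle_rep (f x) + circle_rep (g x)))"
    by (simp add: plus_circle.abs_eq[symmetric])
  show ?thesis unfolding eq by measurable
qed

lemma measurable_uminus_circle [measurable (raw)]:
  fixes f :: "'a \<Rightarrow> circle"
  assumes [measurable]: "f \<in> borel_measurable M"
  shows "(\<lambda>x. - f x) \<in> borel_measurable M"
proof -
  have eq: "(\<lambda>x. - f x) = (\<lambda>x. abs_circle (- circle_rep (f x)))"
    by (simp add: uminus_circle.abs_eq[symmetric])
  show ?thesis unfolding eq by measurable
qed

lemma measurable_minus_circle [measurable (raw)]:
  fixes f g :: "'a \<Rightarrow> circle"
  assumes [measurable]: "f \<in> borel_measurable M" "g \<in> borel_measurable M"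
  shows "(\<lambda>x. f x - g x) \<in> borel_measurable M"
  unfolding diff_conv_add_uminus by measurable

lemma emeasure_haar:
  assumes "A \<in> sets borel"
  shows "emeasure haar A = emeasure lborel (abs_circle -` A \<inter> {0..<1})"
proof -
  have [measurable]: "abs_circle -` A \<in> sets borel"
    using measurable_sets[OF measurable_abs_circle assms] by simp
  have "emeasure haar A = emeasure (restrict_space lborel {0..<1}) (abs_circle -` A \<inter> {0..<1})"
    unfolding haar_def using assms
    by (subst emeasure_distr) (auto intro!: measurable_restrict_space1 simp: space_restrict_space)
  also have "\<dots> = emeasure lborel (abs_circle -` A \<inter> {0..<1})"
    by (rule emeasure_restrict_space) auto
  finally show ?thesis .
qed

lemma emeasure_haar_UNIV [simp]: "emeasure haar UNIV = 1"
  by (simp add: emeasure_haar)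

interpretation haar: finite_measure haar
  by (rule finite_measureI) simp

interpretation haar_pair: pair_sigma_finite haar haar
  by unfold_locales

lemma emeasure_lborel_translate:
  assumes "S \<in> sets borel"
  shows "emeasure lborel ((\<lambda>x. a + x) -` S) = emeasure lborel (S :: real set)"
proof -
  have "emeasure lborel S = emeasure (distr lborel borel ((+) a)) S"
    by (simp add: lborel_distr_plus)
  also have "\<dots> = emeasure lborel ((\<lambda>x. a + x) -` S)"
    using assms by (subst emeasure_distr) auto
  finally show ?thesis by simp
qed

lemma emeasure_haar_shift:
  assumes "A \<in> sets borel" and t: "0 \<le> t" "t \<le> 1"
  shows "emeasure haar A = emeasure lborel (abs_circle -` A \<inter> {t..<t+1})"
proof -
  define P where "P = abs_circle -` A"
  have [measurable]: "P \<in> sets borel"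
    using measurable_sets[OF measurable_abs_circle assms(1)] by (simp add: P_def)
  have per: "1 + x \<in> P \<longleftrightarrow> x \<in> P" for x
  proof -
    have "abs_circle (1 + x) = abs_circle x" by (simp add: abs_circle_eq_iff)
    then show ?thesis by (simp add: P_def)
  qed
  have "emeasure lborel (P \<inter> {t..<t+1}) = emeasure lborel (P \<inter> {t..<1}) + emeasure lborel (P \<inter> {1..<t+1})"
    using t by (subst plus_emeasure) (auto intro!: arg_cong[where f = "emeasure lborel"])
  also have "emeasure lborel (P \<inter> {1..<t+1}) = emeasure lborel ((\<lambda>x. 1 + x) -` (P \<inter> {1..<t+1}))"
    by (subst emeasure_lborel_translate) auto
  also have "(\<lambda>x. 1 + x) -` (P \<inter> {1..<t+1}) = P \<inter> {0..<t}"
    by (auto simp: per)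
  also have "emeasure lborel (P \<inter> {t..<1}) + emeasure lborel (P \<inter> {0..<t}) = emeasure lborel (P \<inter> {0..<1})"
    using t by (subst plus_emeasure) (auto intro!: arg_cong[where f = "emeasure lborel"])
  finally show ?thesis
    using assms(1) by (simp add: emeasure_haar P_def)
qed

lemma haar_translate: "distr haar borel (\<lambda>x. x + a) = haar"
proof (rule measure_eqI)
  fix A assume "A \<in> sets (distr haar borel (\<lambda>x. x + a))"
  then have A: "A \<in> sets borel" by simp
  define t where "t = circle_rep a"
  have t: "0 \<le> t" "t \<le> 1" and a: "a = abs_circle t"
    using circle_rep_range[of a] by (auto simp: t_def)
  have P: "abs_circle -` A \<in> sets borel"
    using measurable_sets[OF measurable_abs_circle A] by simp
  have B: "(\<lambda>x. x + a) -` A \<in> sets borel"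
    using measurable_sets[of "\<lambda>x. x + a" borel borel A] A by simp
  have "emeasure (distr haar borel (\<lambda>x. x + a)) A = emeasure haar ((\<lambda>x. x + a) -` A)"
    using A by (subst emeasure_distr) auto
  also have "\<dots> = emeasure lborel (abs_circle -` (\<lambda>x. x + a) -` A \<inter> {0..<1})"
    using B by (rule emeasure_haar)
  also have "abs_circle -` (\<lambda>x. x + a) -` A \<inter> {0..<1} = (\<lambda>x. t + x) -` (abs_circle -` A \<inter> {t..<t+1})"
    by (auto simp: a plus_circle.abs_eq add.commute)
  also have "emeasure lborel \<dots> = emeasure lborel (abs_circle -` A \<inter> {t..<t+1})"
    using P by (intro emeasure_lborel_translate) auto
  also have "\<dots> = emeasure haar A"
    using emeasure_haar_shift[OF A t] by simp
  finally show "emeasure (distr haar borel (\<lambda>x. x + a)) A = emeasure haar A" .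
qed simp

lemma haar_uminus: "distr haar borel uminus = haar"
proof (rule measure_eqI)
  fix A assume "A \<in> sets (distr haar borel uminus)"
  then have A: "A \<in> sets borel" by simp
  define P where "P = abs_circle -` A"
  have P [measurable]: "P \<in> sets borel"
    using measurable_sets[OF measurable_abs_circle A] by (simp add: P_def)
  have B: "uminus -` A \<in> sets borel"
    using measurable_sets[of "\<lambda>x::circle. - x" borel borel A] A by simp
  have per: "x - 1 \<in> P \<longleftrightarrow> x \<in> P" for x
  proof -
    have "abs_circle (x - 1) = abs_circle x" by (simp add: abs_circle_eq_iff)
    then show ?thesis by (simp add: P_def)
  qed
  have "emeasure (distr haar borel uminus) A = emeasure haar (uminus -` A)"
    using A by (subst emeasure_distr) auto
  also have "\<dots> = emeasure lborel (abs_circle -` uminus -` A \<inter> {0..<1})"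
    using B by (rule emeasure_haar)
  also have "abs_circle -` uminus -` A \<inter> {0..<1} = uminus -` (P \<inter> {-1<..0})"
    by (auto simp: P_def uminus_circle.abs_eq)
  also have "emeasure lborel \<dots> = emeasure (distr lborel borel uminus) (P \<inter> {-1<..0})"
    by (subst emeasure_distr) auto
  also have "\<dots> = emeasure lborel ((\<lambda>x. -1 + x) -` (P \<inter> {-1<..0}))"
    unfolding lborel_distr_uminus by (rule emeasure_lborel_translate[symmetric]) simp
  also have "(\<lambda>x. -1 + x) -` (P \<inter> {-1<..0}) = P \<inter> {0<..1}"
    using per by auto
  also have "emeasure lborel (P \<inter> {0<..1}) = emeasure lborel (P \<inter> {0..<1})"
  proof (rule emeasure_eq_AE)
    show "AE x in lborel. x \<in> P \<inter> {0<..1} \<longleftrightarrow> x \<in> P \<inter> {0..<1}"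
      using AE_lborel_singleton[of 0] AE_lborel_singleton[of 1] by eventually_elim auto
  qed auto
  also have "\<dots> = emeasure haar A"
    using A by (simp add: emeasure_haar P_def)
  finally show "emeasure (distr haar borel uminus) A = emeasure haar A" .
qed simp

lemma haar_reflect: "distr haar borel (\<lambda>x. a - x) = haar"
proof -
  have "distr haar borel (\<lambda>x. a - x) = distr (distr haar borel uminus) borel (\<lambda>x. x + a)"
    by (subst distr_distr) (auto simp: comp_def)
  then show ?thesis by (simp add: haar_uminus haar_translate)
qed


section \<open>The space \<open>L\<^sup>1(S\<^sup>1)\<close>\<close>

text \<open>Every Lebesgue class contains a Borel function, so classes of Borel functions suffice.\<close>

quotient_type L1_circle = "circle \<Rightarrow> complex" / partial:
  "\<lambda>f g. integrable haar f \<and> integrable haar g \<and> (AE x in haar. f x = g x)"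
proof (rule part_equivpI)
  show "\<exists>f::circle \<Rightarrow> complex. integrable haar f \<and> integrable haar f \<and> (AE x in haar. f x = f x)"
    by (rule exI[of _ "\<lambda>_. 0"]) simp
  show "symp (\<lambda>f g::circle \<Rightarrow> complex. integrable haar f \<and> integrable haar g \<and> (AE x in haar. f x = g x))"
    by (rule sympI) auto
  show "transp (\<lambda>f g::circle \<Rightarrow> complex. integrable haar f \<and> integrable haar g \<and> (AE x in haar. f x = g x))"
  proof (rule transpI)
    fix f g h :: "circle \<Rightarrow> complex"
    assume fg: "integrable haar f \<and> integrable haar g \<and> (AE x in haar. f x = g x)"
      and gh: "integrable haar g \<and> integrable haar h \<and> (AE x in haar. g x = h x)"
    from fg gh have "AE x in haar. f x = g x" "AE x in haar. g x = h x" by auto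
    then have "AE x in haar. f x = h x" by eventually_elim simp
    with fg gh show "integrable haar f \<and> integrable haar h \<and> (AE x in haar. f x = h x)" by simp
  qed
qed

instantiation L1_circle :: real_normed_vector
begin

lift_definition zero_L1_circle :: L1_circle is "\<lambda>_. 0"
  by simp

lift_definition plus_L1_circle :: "L1_circle \<Rightarrow> L1_circle \<Rightarrow> L1_circle" is "\<lambda>f g x. f x + g x"
  by auto

lift_definition minus_L1_circle :: "L1_circle \<Rightarrow> L1_circle \<Rightarrow> L1_circle" is "\<lambda>f g x. f x - g x"
  by auto

lift_definition uminus_L1_circle :: "L1_circle \<Rightarrow> L1_circle" is "\<lambda>f x. - f x"
  by auto

lift_definition scaleR_L1_circle :: "real \<Rightarrow> L1_circle \<Rightarrow> L1_circle" is "\<lambda>r f x. r *\<^sub>R f x"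
  by auto

lift_definition norm_L1_circle :: "L1_circle \<Rightarrow> real" is "\<lambda>f. \<integral>x. norm (f x) \<partial>haar"
  by (rule integral_cong_AE) auto

definition dist_L1_circle :: "L1_circle \<Rightarrow> L1_circle \<Rightarrow> real" where
  "dist_L1_circle f g = norm (f - g)"

definition sgn_L1_circle :: "L1_circle \<Rightarrow> L1_circle" where
  "sgn_L1_circle f = scaleR (inverse (norm f)) f"

definition uniformity_L1_circle :: "(L1_circle \<times> L1_circle) filter" where
  "uniformity_L1_circle = (INF e\<in>{0<..}. principal {(f, g). dist f g < e})"

definition open_L1_circle :: "L1_circle set \<Rightarrow> bool" where
  "open_L1_circle U \<longleftrightarrow> (\<forall>f\<in>U. eventually (\<lambda>(f', g). f' = f \<longrightarrow> g \<in> U) uniformity)"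

instance
proof
  fix f g h :: L1_circle and r s :: real
  show "f + g + h = f + (g + h)" by transfer (simp add: add.assoc)
  show "f + g = g + f" by transfer (simp add: add.commute)
  show "0 + f = f" by transfer simp
  show "- f + f = 0" by transfer simp
  show "f - g = f + - g" by transfer simp
  show "r *\<^sub>R (f + g) = r *\<^sub>R f + r *\<^sub>R g" by transfer (simp add: scaleR_add_right)
  show "(r + s) *\<^sub>R f = r *\<^sub>R f + s *\<^sub>R f" by transfer (simp add: scaleR_add_left)
  show "r *\<^sub>R s *\<^sub>R f = (r * s) *\<^sub>R f" by transfer simp
  show "1 *\<^sub>R f = f" by transfer simp
  show "dist f g = norm (f - g)" by (rule dist_L1_circle_def)
  show "sgn f = scaleR (inverse (norm f)) f" by (rule sgn_L1_circle_def)
  show "uniformity = (INF e\<in>{0<..}. principal {(f::L1_circle, g). dist f g < e})"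
    by (rule uniformity_L1_circle_def)
  show "open U \<longleftrightarrow> (\<forall>f\<in>U. \<forall>\<^sub>F (f', g) in uniformity. f' = f \<longrightarrow> g \<in> U)" for U :: "L1_circle set"
    by (rule open_L1_circle_def)
  show "norm f = 0 \<longleftrightarrow> f = 0"
  proof transfer
    fix f :: "circle \<Rightarrow> complex"
    assume "integrable haar f \<and> integrable haar f \<and> (AE x in haar. f x = f x)"
    then have f: "integrable haar f" by simp
    then have [measurable]: "f \<in> borel_measurable borel"
      by (auto dest: borel_measurable_integrable)
    have "(AE x in haar. f x = 0) \<longleftrightarrow> emeasure haar {x. f x \<noteq> 0} = 0"
      by (rule AE_iff_measurable) auto
    with f show "(\<integral>x. norm (f x) \<partial>haar) = 0 \<longleftrightarrow>
        integrable haar f \<and> integrable haar (\<lambda>_. 0 :: complex) \<and> (AE x in haar. f x = 0)"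
      by (simp add: integral_norm_eq_0_iff)
  qed
  show "norm (f + g) \<le> norm f + norm g"
  proof transfer
    fix f g :: "circle \<Rightarrow> complex"
    assume "integrable haar f \<and> integrable haar f \<and> (AE x in haar. f x = f x)"
      and "integrable haar g \<and> integrable haar g \<and> (AE x in haar. g x = g x)"
    then have "integrable haar f" "integrable haar g" by auto
    then have "(\<integral>x. norm (f x + g x) \<partial>haar) \<le> (\<integral>x. norm (f x) + norm (g x) \<partial>haar)"
      by (intro integral_mono) (auto intro: norm_triangle_ineq)
    then show "(\<integral>x. norm (f x + g x) \<partial>haar) \<le> (\<integral>x. norm (f x) \<partial>haar) + (\<integral>x. norm (g x) \<partial>haar)"
      using \<open>integrable haar f\<close> \<open>integrable haar g\<close> by simp
  qed
  show "norm (r *\<^sub>R f) = \<bar>r\<bar> * norm f" by transfer simp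
qed

end

text \<open>The library has no class of complex normed spaces, so scalar multiplication by complex
  numbers is a separate operation, compatible with \<open>scaleR\<close>.\<close>

lift_definition cscale :: "complex \<Rightarrow> L1_circle \<Rightarrow> L1_circle" is "\<lambda>c f x. c * f x"
  by auto

lemma vector_space_cscale: "vector_space cscale"
  by unfold_locales (transfer; simp add: algebra_simps)+

lemma cscale_of_real: "cscale (of_real r) f = r *\<^sub>R f"
  by transfer (simp add: scaleR_conv_of_real)

section \<open>Cosine convolution\<close>

lemma integrable_haar_translate:
  fixes g :: "circle \<Rightarrow> complex"
  assumes "integrable haar g"
  shows "integrable haar (\<lambda>x. g (x + a))"
proof -
  have "integrable (distr haar borel (\<lambda>x. x + a)) g"
    using assms by (simp add: haar_translate)
  then show ?thesis by (rule integrable_distr[rotated]) simp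
qed

lemma integral_haar_translate:
  fixes g :: "circle \<Rightarrow> 'b :: {banach, second_countable_topology}"
  assumes [measurable]: "g \<in> borel_measurable borel"
  shows "(\<integral>x. g (x + a) \<partial>haar) = (\<integral>x. g x \<partial>haar)"
proof -
  have "(\<integral>x. g x \<partial>distr haar borel (\<lambda>x. x + a)) = (\<integral>x. g (x + a) \<partial>haar)"
    by (rule integral_distr) simp_all
  then show ?thesis by (simp add: haar_translate)
qed

lemma integrable_pair_translate:
  fixes f g :: "circle \<Rightarrow> complex" and s :: "circle \<Rightarrow> circle"
  assumes f: "integrable haar f" and g: "integrable haar g"
    and [measurable]: "s \<in> borel_measurable borel"
  shows "integrable (haar \<Otimes>\<^sub>M haar) (\<lambda>(y, x). f y * g (x + s y))"
proof (rule haar_pair.Fubini_integrable)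
  have [measurable]: "f \<in> borel_measurable borel" "g \<in> borel_measurable borel"
    using f g by (auto dest: borel_measurable_integrable)
  show "(\<lambda>(y, x). f y * g (x + s y)) \<in> borel_measurable (haar \<Otimes>\<^sub>M haar)"
    by measurable
  have "(\<integral>x. norm (f y * g (x + s y)) \<partial>haar) = norm (f y) * (\<integral>x. norm (g x) \<partial>haar)" for y
    using integral_haar_translate[of "\<lambda>x. norm (g x)" "s y"] by (simp add: norm_mult)
  then show "integrable haar (\<lambda>y. \<integral>x. norm (case (y, x) of (y, x) \<Rightarrow> f y * g (x + s y)) \<partial>haar)"
    using f by simp
  show "AE y in haar. integrable haar (\<lambda>x. case (y, x) of (y, x) \<Rightarrow> f y * g (x + s y))"
    using integrable_haar_translate[OF g] by simp
qed

lemma integrable_pair_cosine: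
  fixes f g :: "circle \<Rightarrow> complex"
  assumes f: "integrable haar f" and g: "integrable haar g"
  shows "integrable (haar \<Otimes>\<^sub>M haar) (\<lambda>(x, y). f y * ((g (x + y) + g (x - y)) / 2))"
proof -
  have "integrable (haar \<Otimes>\<^sub>M haar) (\<lambda>p. (case p of (y, x) \<Rightarrow> f y * g (x + y)) / 2 +
      (case p of (y, x) \<Rightarrow> f y * g (x + - y)) / 2)"
    using integrable_pair_translate[OF f g, of "\<lambda>y. y"] integrable_pair_translate[OF f g, of uminus]
    by simp
  also have "(\<lambda>p. (case p of (y, x) \<Rightarrow> f y * g (x + y)) / 2 + (case p of (y, x) \<Rightarrow> f y * g (x + - y)) / 2)
      = (\<lambda>(y, x). f y * ((g (x + y) + g (x - y)) / 2))"
    by (auto simp: fun_eq_iff field_simps)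
  finally show ?thesis
    using haar_pair.integrable_product_swap by fastforce
qed

lemma AE_haar_translate:
  fixes f g :: "circle \<Rightarrow> complex"
  assumes "AE y in haar. f y = g y"
    and [measurable]: "f \<in> borel_measurable borel" "g \<in> borel_measurable borel"
  shows "AE y in haar. f (x + y) = g (x + y)" "AE y in haar. f (x - y) = g (x - y)"
proof -
  have "AE y in distr haar borel (\<lambda>y. y + x). f y = g y" "AE y in distr haar borel (\<lambda>y. x - y). f y = g y"
    using assms(1) by (simp_all only: haar_translate haar_reflect)
  then show "AE y in haar. f (x + y) = g (x + y)" "AE y in haar. f (x - y) = g (x - y)"
    by (simp_all add: AE_distr_iff add.commute)
qed

text \<open>The integral below exists for almost every \<open>x\<close>; the Bochner integral takes the value \<open>0\<close> at
  the remaining points, which does not affect the class.\<close>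

lift_definition cosine_conv :: "L1_circle \<Rightarrow> L1_circle \<Rightarrow> L1_circle" (infixl "\<star>\<^sub>c" 70)
  is "\<lambda>f g x. \<integral>y. f y * ((g (x + y) + g (x - y)) / 2) \<partial>haar"
proof (intro conjI AE_I2)
  fix f f' g g' :: "circle \<Rightarrow> complex" and x :: circle
  assume F: "integrable haar f \<and> integrable haar f' \<and> (AE x in haar. f x = f' x)"
    and G: "integrable haar g \<and> integrable haar g' \<and> (AE x in haar. g x = g' x)"
  show "integrable haar (\<lambda>x. \<integral>y. f y * ((g (x + y) + g (x - y)) / 2) \<partial>haar)"
    using haar_pair.integrable_fst'[OF integrable_pair_cosine[of f g]] F G by simp
  show "integrable haar (\<lambda>x. \<integral>y. f' y * ((g' (x + y) + g' (x - y)) / 2) \<partial>haar)"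
    using haar_pair.integrable_fst'[OF integrable_pair_cosine[of f' g']] F G by simp
  have [measurable]: "f \<in> borel_measurable borel" "f' \<in> borel_measurable borel"
    "g \<in> borel_measurable borel" "g' \<in> borel_measurable borel"
    using F G by (auto dest: borel_measurable_integrable)
  have "AE y in haar. g (x + y) = g' (x + y)" "AE y in haar. g (x - y) = g' (x - y)"
    using AE_haar_translate[of g g' x] G by simp_all
  moreover from F have "AE y in haar. f y = f' y" by simp
  ultimately have "AE y in haar. f y * ((g (x + y) + g (x - y)) / 2) = f' y * ((g' (x + y) + g' (x - y)) / 2)"
    by eventually_elim simp
  then show "(\<integral>y. f y * ((g (x + y) + g (x - y)) / 2) \<partial>haar) =
      (\<integral>y. f' y * ((g' (x + y) + g' (x - y)) / 2) \<partial>haar)"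
    by (intro integral_cong_AE) measurable
qed

section \<open>The structure space\<close>

definition L1_dual :: "(L1_circle \<Rightarrow> complex) set" where
  "L1_dual = {m. Vector_Spaces.linear cscale (*) m \<and> continuous_on UNIV m}"

text \<open>The coarsest topology on the dual making all evaluations continuous.\<close>

definition weak_star :: "(L1_circle \<Rightarrow> complex) topology" where
  "weak_star = topology_generated_by {{m \<in> L1_dual. m f \<in> U} |f U. open U}"

definition structure_space :: "(L1_circle \<Rightarrow> complex) set" where
  "structure_space = {m \<in> L1_dual. m \<noteq> (\<lambda>_. 0) \<and> (\<forall>f g. m (f \<star>\<^sub>c g) = m f * m g)}"

lemma topspace_weak_star [simp]: "topspace weak_star = L1_dual"
  by (auto simp: weak_star_def intro!: exI[of _ UNIV])

end

theory Submission
  imports Defs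
begin

text \<open>Write \<open>E(x) = exp(2\<pi>ix)\<close> and \<open>c\<^sub>n = (E\<^sup>n + E\<^sup>-\<^sup>n)/2\<close>, the \<open>n\<close>-th cosine wave. The addition formula
  \<open>(c\<^sub>n(x + y) + c\<^sub>n(x - y))/2 = c\<^sub>n(x) c\<^sub>n(y)\<close> has two consequences. By Fubini, the cosine coefficient
  \<open>f \<mapsto> \<integral> f c\<^sub>n\<close> is multiplicative for the cosine convolution (\<open>cosine_coeff_cosine_conv\<close>).
  Moreover \<open>f \<star>\<^sub>c c\<^sub>n = (\<integral> f c\<^sub>n) \<cdot> c\<^sub>n\<close> (\<open>cosine_conv_cosine_wave\<close>), so that applying a character \<open>m\<close> gives
  \<open>m(f) m(c\<^sub>n) = (\<integral> f c\<^sub>n) m(c\<^sub>n)\<close>: as soon as \<open>m(c\<^sub>n) \<noteq> 0\<close>, \<open>m\<close> is the \<open>n\<close>-th cosine coefficient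
  (\<open>character_eq_cosine_coeff\<close>).

  A character cannot vanish on every \<open>c\<^sub>n\<close>. If \<open>f\<close> is odd then \<open>f \<star>\<^sub>c g = 0\<close> for all \<open>g\<close>, so
  characters vanish on odd functions, in particular on sine waves. A character vanishing on all
  cosine waves therefore vanishes on all \<open>E\<^sup>n\<close> and \<open>E\<^sup>-\<^sup>n\<close>; since trigonometric polynomials are dense in
  \<open>L\<^sup>1\<close> (\<open>trig_monomials_total\<close>), it is zero, which is excluded.

  So the structure space is exactly the set of cosine coefficients. By orthogonality of the
  \<open>c\<^sub>n\<close>, evaluation at \<open>c\<^sub>n\<close> is nonzero at the \<open>n\<close>-th cosine coefficient and at no other character. Hence
  the cosine coefficients are pairwise distinct, and the weak* open set \<open>{m. m(c\<^sub>n) \<noteq> 0}\<close> isolates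
  the \<open>n\<close>-th one: the topology is discrete on a countably infinite set.\<close>

section \<open>Classes of integrable functions\<close>

lemma L1_circle_cases:
  obtains f where "integrable haar f" "u = abs_L1_circle f"
proof -
  have "\<exists>f. integrable haar f \<and> u = abs_L1_circle f"
    using Quotient_rep_reflp[OF Quotient_L1_circle, of u] Quotient_abs_rep[OF Quotient_L1_circle, of u]
    by metis
  then show ?thesis using that by blast
qed

lemma abs_L1_circle_add:
  "integrable haar f \<Longrightarrow> integrable haar g \<Longrightarrow>
    abs_L1_circle f + abs_L1_circle g = abs_L1_circle (\<lambda>x. f x + g x)"
  by (simp add: plus_L1_circle.abs_eq)

lemma abs_L1_circle_diff:
  "integrable haar f \<Longrightarrow> integrable haar g \<Longrightarrow>
    abs_L1_circle f - abs_L1_circle g = abs_L1_circle (\<lambda>x. f x - g x)"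
  by (simp add: minus_L1_circle.abs_eq)

lemma norm_abs_L1_circle:
  "integrable haar f \<Longrightarrow> norm (abs_L1_circle f) = (\<integral>x. norm (f x) \<partial>haar)"
  by (simp add: norm_L1_circle.abs_eq)

lemma cscale_abs_L1_circle:
  "integrable haar f \<Longrightarrow> cscale c (abs_L1_circle f) = abs_L1_circle (\<lambda>x. c * f x)"
  by (simp add: cscale.abs_eq)

lemma cosine_conv_abs_L1_circle:
  "integrable haar f \<Longrightarrow> integrable haar g \<Longrightarrow> abs_L1_circle f \<star>\<^sub>c abs_L1_circle g =
    abs_L1_circle (\<lambda>x. \<integral>y. f y * ((g (x + y) + g (x - y)) / 2) \<partial>haar)"
  by (simp add: cosine_conv.abs_eq)

lemma L1_dual_add: "m \<in> L1_dual \<Longrightarrow> m (u + v) = m u + m v"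
  by (simp add: L1_dual_def Vector_Spaces.linear_iff)

lemma L1_dual_cscale: "m \<in> L1_dual \<Longrightarrow> m (cscale c u) = c * m u"
  by (simp add: L1_dual_def Vector_Spaces.linear_iff)

text \<open>Dominated convergence, read as norm convergence in \<open>L\<^sup>1\<close>.\<close>

lemma tendsto_abs_L1_circle:
  fixes f :: "circle \<Rightarrow> complex"
  assumes "f \<in> borel_measurable haar" "\<And>i. s i \<in> borel_measurable haar" "integrable haar w"
    and "AE x in haar. (\<lambda>i. s i x) \<longlonglongrightarrow> f x" "\<And>i. AE x in haar. norm (s i x) \<le> w x"
  shows "(\<lambda>i. abs_L1_circle (s i)) \<longlonglongrightarrow> abs_L1_circle f"
proof -
  have int: "integrable haar f" "\<And>i. integrable haar (s i)"
    using integrable_dominated_convergence[OF assms] integrable_dominated_convergence2[OF assms] 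
    by auto
  have lim: "(\<lambda>i. \<integral>x. norm (s i x - f x) \<partial>haar) \<longlonglongrightarrow> (\<integral>x. 0 \<partial>haar)"
  proof (rule integral_dominated_convergence[where w="\<lambda>x. w x + norm (f x)"])
    show "AE x in haar. (\<lambda>i. norm (s i x - f x)) \<longlonglongrightarrow> 0"
      using assms(4) by eventually_elim (simp add: LIM_zero tendsto_norm_zero)
    show "AE x in haar. norm (norm (s i x - f x)) \<le> w x + norm (f x)" for i
      using assms(5)[of i] by eventually_elim (smt (verit) norm_triangle_ineq4 real_norm_def norm_ge_zero)
  qed (use assms(1-3) int in auto)
  have "norm (abs_L1_circle (s i) - abs_L1_circle f) = (\<integral>x. norm (s i x - f x) \<partial>haar)" for i
    using int by (simp add: abs_L1_circle_diff norm_abs_L1_circle)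
  then have "(\<lambda>i. norm (abs_L1_circle (s i) - abs_L1_circle f)) \<longlonglongrightarrow> 0"
    using lim by simp
  then show ?thesis using LIM_zero_cancel tendsto_norm_zero_iff by blast
qed

text \<open>Density statements are proved dually, by enlarging step by step the set of functions on whose
  classes a continuous functional vanishes. Integrability is part of the predicate because the
  class of a function is only meaningful for integrable functions.\<close>

definition annihilates :: "(L1_circle \<Rightarrow> complex) \<Rightarrow> (circle \<Rightarrow> complex) \<Rightarrow> bool" where
  "annihilates m f \<longleftrightarrow> integrable haar f \<and> m (abs_L1_circle f) = 0"

lemma annihilates_add:
  "m \<in> L1_dual \<Longrightarrow> annihilates m f \<Longrightarrow> annihilates m g \<Longrightarrow> annihilates m (\<lambda>x. f x + g x)"
  by (auto simp: annihilates_def L1_dual_add simp flip: abs_L1_circle_add)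

lemma annihilates_mult:
  "m \<in> L1_dual \<Longrightarrow> annihilates m f \<Longrightarrow> annihilates m (\<lambda>x. c * f x)"
  by (auto simp: annihilates_def L1_dual_cscale simp flip: cscale_abs_L1_circle)

lemma annihilates_sum:
  "m \<in> L1_dual \<Longrightarrow> (\<And>i. i \<in> I \<Longrightarrow> annihilates m (f i)) \<Longrightarrow> annihilates m (\<lambda>x. \<Sum>i\<in>I. f i x)"
proof (induction I rule: infinite_finite_induct)
  case (insert i I)
  then show ?case using annihilates_add[of m "f i" "\<lambda>x. \<Sum>i\<in>I. f i x"] by simp
qed (use annihilates_mult[of m _ 0] L1_dual_cscale[of m 0 "abs_L1_circle (\<lambda>_. 0)"] 
      in \<open>auto simp: annihilates_def cscale_abs_L1_circle\<close>)

text \<open>The functions annihilated by a continuous functional are closed under dominated pointwise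
  limits; every approximation step in the density proof is an instance of this.\<close>

lemma annihilates_limit:
  assumes m: "m \<in> L1_dual" and s: "\<And>i. annihilates m (s i)"
    and lim: "\<And>x. (\<lambda>i. s i x) \<longlonglongrightarrow> f x"
    and w: "integrable haar w" and bound: "\<And>i x. norm (s i x) \<le> w x"
  shows "annihilates m f"
proof -
  have ms: "s i \<in> borel_measurable haar" for i
    using s[of i] by (auto simp: annihilates_def dest: borel_measurable_integrable)
  have mf: "f \<in> borel_measurable haar"
    by (rule borel_measurable_LIMSEQ_metric[OF ms]) (use lim in auto)
  have "integrable haar f"
    by (rule integrable_dominated_convergence[of f haar s w]) (use lim bound mf ms w in auto)
  moreover have "(\<lambda>i. m (abs_L1_circle (s i))) \<longlonglongrightarrow> m (abs_L1_circle f)"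
    by (rule continuous_on_tendsto_compose[of UNIV m, OF _ tendsto_abs_L1_circle[of f s w]])
       (use m lim bound mf ms w in \<open>auto simp: L1_dual_def\<close>)
  then have "m (abs_L1_circle f) = 0"
    using s LIMSEQ_unique[OF _ tendsto_const] by (auto simp: annihilates_def)
  ultimately show ?thesis by (simp add: annihilates_def)
qed

section \<open>Trigonometric polynomials\<close>

lift_definition circle_exp :: "circle \<Rightarrow> complex" is "\<lambda>x. cis (2 * pi * x)"
proof -
  fix x y :: real assume "x - y \<in> \<int>"
  then obtain k where "x = y + of_int k" by (metis Ints_cases add.commute diff_add_cancel)
  then have "cis (2 * pi * x) = cis (2 * pi * y) * cis (2 * pi * of_int k)"
    by (simp add: cis_mult algebra_simps)
  then show "cis (2 * pi * x) = cis (2 * pi * y)"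
    by (simp add: cis_multiple_2pi)
qed

lemma circle_exp_add: "circle_exp (x + y) = circle_exp x * circle_exp y"
  by transfer (simp add: cis_mult algebra_simps)

lemma circle_exp_minus: "circle_exp (- x) = cnj (circle_exp x)"
  by transfer (simp add: cis_cnj)

lemma norm_circle_exp [simp]: "norm (circle_exp x) = 1"
  by transfer simp

lemma circle_exp_mult_cnj [simp]: "circle_exp x * cnj (circle_exp x) = 1"
  by (simp add: complex_norm_square[symmetric])

lemma circle_exp_power_cancel:
  assumes "k \<le> n"
  shows "circle_exp x ^ n * cnj (circle_exp x) ^ k = circle_exp x ^ (n - k)"
    and "cnj (circle_exp x) ^ n * circle_exp x ^ k = cnj (circle_exp x) ^ (n - k)"
proof -
  let ?z = "circle_exp x"
  have 1: "?z ^ k * cnj ?z ^ k = 1"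
    by (simp flip: power_mult_distrib)
  have 2: "?z ^ n = ?z ^ (n - k) * ?z ^ k" "cnj ?z ^ n = cnj ?z ^ (n - k) * cnj ?z ^ k"
    using assms by (simp_all flip: power_add)
  show "?z ^ n * cnj ?z ^ k = ?z ^ (n - k)" "cnj ?z ^ n * ?z ^ k = cnj ?z ^ (n - k)"
    using 1 by (simp_all add: 2 mult.assoc mult.commute[of "cnj ?z ^ k"])
qed

lemma circle_exp_eqI:
  assumes "circle_exp x = circle_exp y" shows "x = y"
  using assms
proof transfer
  fix x y :: real assume "cis (2 * pi * x) = cis (2 * pi * y)"
  then obtain n :: int where "2 * pi * x = 2 * pi * y + 2 * pi * n"
    by (metis cis.sel complex_eq_iff sin_cos_eq_iff)
  then have "x - y = of_int n" by (simp flip: distrib_left)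
  then show "x - y \<in> \<int>" by simp
qed

lemma measurable_circle_exp [measurable]: "circle_exp \<in> borel_measurable borel"
proof -
  have "circle_exp = (\<lambda>x. cis (2 * pi * circle_rep x))"
    by (metis abs_circle_rep circle_exp.abs_eq)
  then show ?thesis
    using measurable_compose[OF measurable_circle_rep, of "\<lambda>t. cis (2 * pi * t)" borel]
    by (simp add: borel_measurable_continuous_onI continuous_intros)
qed

lemma measurable_cnj_circle_exp [measurable]: "(\<lambda>x. cnj (circle_exp x)) \<in> borel_measurable borel"
  unfolding circle_exp_minus[symmetric] by measurable

text \<open>The circle is Borel isomorphic to its image in the plane: the angle is recovered from the real
  part by the arc cosine, up to a sign which the imaginary part decides. Through this map every Borel
  subset of the circle is the preimage of a Borel set of complex numbers under \<open>circle_exp\<close>.\<close>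

lemma circle_exp_section:
  obtains \<sigma> where "\<sigma> \<in> borel_measurable borel" "\<And>x. \<sigma> (circle_exp x) = x"
proof -
  \<comment> \<open>Off the unit circle only measurability matters; truncating to \<open>[-1, 1]\<close> makes \<open>a\<close> continuous everywhere.\<close>
  define a where "a z = arccos (max (-1) (min 1 (Re z))) / (2 * pi)" for z
  define \<sigma> where "\<sigma> z = abs_circle (if 0 \<le> Im z then a z else - a z)" for z
  have "continuous_on UNIV (\<lambda>z. arccos (max (-1) (min 1 (Re z))) / (2 * pi))"
    by (intro continuous_intros) auto
  then have [measurable]: "a \<in> borel_measurable borel"
    unfolding a_def by (rule borel_measurable_continuous_onI)
  have "\<sigma> \<in> borel_measurable borel"
    unfolding \<sigma>_def by measurable
  moreover have "\<sigma> (circle_exp x) = x" for x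
  proof (rule circle_exp_eqI)
    let ?z = "circle_exp x"
    have n: "(Re ?z)\<^sup>2 + (Im ?z)\<^sup>2 = 1" using norm_circle_exp[of x] by (simp add: cmod_def)
    have r: "\<bar>Re ?z\<bar> \<le> 1" using abs_Re_le_cmod[of ?z] by simp
    then have "max (-1) (min 1 (Re ?z)) = Re ?z" by linarith
    then have "2 * pi * a ?z = arccos (Re ?z)" by (simp add: a_def)
    moreover have "sqrt (1 - (Re ?z)\<^sup>2) = \<bar>Im ?z\<bar>"
      using n by (metis add_diff_cancel_left' real_sqrt_abs)
    ultimately show "circle_exp (\<sigma> ?z) = ?z"
      using r by (auto simp: \<sigma>_def circle_exp.abs_eq complex_eq_iff sin_arccos_abs abs_le_iff cos_arccos)
  qed
  ultimately show ?thesis by (rule that)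
qed

lemma integrable_bounded_haar:
  fixes f :: "circle \<Rightarrow> complex"
  assumes "f \<in> borel_measurable borel" "\<And>x. norm (f x) \<le> B"
  shows "integrable haar f"
  using assms by (intro haar.integrable_const_bound[where B=B]) (auto cong: measurable_cong_sets)

section \<open>Totality of the trigonometric monomials\<close>

text \<open>Composed with \<open>circle_exp\<close>, a real polynomial in \<open>Re z\<close> and \<open>Im z\<close> becomes a trigonometric
  polynomial. The extra factor \<open>g\<close>, and the closure of the hypothesis under multiplication by
  \<open>z\<close> and its conjugate, make the statement inductive: for a product \<open>p q\<close>, the hypothesis for \<open>p\<close>
  is applied to \<open>q g\<close>, and linear forms are combinations of \<open>z\<close> and its conjugate.\<close>

lemma annihilates_polynomial_mult:
  assumes p: "real_polynomial_function p" and m: "m \<in> L1_dual"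
    and "\<And>j k. annihilates m (\<lambda>x. g x * circle_exp x ^ j * cnj (circle_exp x) ^ k)"
  shows "annihilates m (\<lambda>x. of_real (p (circle_exp x)) * g x * circle_exp x ^ j * cnj (circle_exp x) ^ k)"
  using p assms(3)
proof (induction p arbitrary: g j k)
  case (linear h)
  define \<alpha> \<beta> where "\<alpha> = (of_real (h 1) - \<i> * of_real (h \<i>)) / 2"
    and "\<beta> = (of_real (h 1) + \<i> * of_real (h \<i>)) / 2"
  have h: "complex_of_real (h z) = \<alpha> * z + \<beta> * cnj z" for z
  proof -
    interpret bounded_linear h by (rule linear.hyps)
    have "h (Re z *\<^sub>R 1 + Im z *\<^sub>R \<i>) = Re z * h 1 + Im z * h \<i>"
      by (simp only: add scaleR real_scaleR_def)
    moreover have "Re z *\<^sub>R 1 + Im z *\<^sub>R \<i> = z" by (simp add: complex_eq_iff)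
    ultimately have "h z = Re z * h 1 + Im z * h \<i>" by metis
    then show ?thesis by (simp add: \<alpha>_def \<beta>_def complex_eq_iff field_simps)
  qed
  have "annihilates m (\<lambda>x. \<alpha> * (g x * circle_exp x ^ Suc j * cnj (circle_exp x) ^ k)
      + \<beta> * (g x * circle_exp x ^ j * cnj (circle_exp x) ^ Suc k))"
    by (intro annihilates_add annihilates_mult m linear.prems)
  then show ?case by (simp add: h algebra_simps)
next
  case (const c)
  then show ?case using annihilates_mult[OF m const, of "of_real c" j k] by (simp add: mult.assoc)
next
  case (add p q)
  show ?case
    using annihilates_add[OF m add.IH(1)[OF add.prems] add.IH(2)[OF add.prems], of j k j k]
    by (simp add: algebra_simps)
next
  case (mult p q)
  show ?case
    using mult.IH(1)[OF mult.IH(2)[OF mult.prems], of j k] by (simp add: mult.assoc)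
qed

lemma annihilates_polynomial:
  assumes p: "real_polynomial_function p" and m: "m \<in> L1_dual"
    and E: "\<And>n. annihilates m (\<lambda>x. circle_exp x ^ n)" "\<And>n. annihilates m (\<lambda>x. cnj (circle_exp x) ^ n)"
  shows "annihilates m (\<lambda>x. of_real (p (circle_exp x)))"
proof -
  have "annihilates m (\<lambda>x. 1 * circle_exp x ^ j * cnj (circle_exp x) ^ k)" for j k
  proof (cases "k \<le> j")
    case True
    then show ?thesis using E(1) by (simp add: circle_exp_power_cancel)
  next
    case False
    then show ?thesis
      using E(2) circle_exp_power_cancel(2)[of j k] by (simp add: mult.commute)
  qed
  from annihilates_polynomial_mult[OF p m this, of 0 0] show ?thesis by simp
qed

text \<open>By the Stone--Weierstrass theorem on the unit circle, \<open>\<phi>\<close> is there a uniform limit of polynomials.\<close>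

lemma annihilates_continuous:
  assumes \<phi>: "continuous_on UNIV \<phi>" and m: "m \<in> L1_dual"
    and E: "\<And>n. annihilates m (\<lambda>x. circle_exp x ^ n)" "\<And>n. annihilates m (\<lambda>x. cnj (circle_exp x) ^ n)"
  shows "annihilates m (\<lambda>x. of_real (\<phi> (circle_exp x)))"
proof -
  have "\<exists>p. real_polynomial_function p \<and> (\<forall>z\<in>sphere 0 1. \<bar>\<phi> z - p z\<bar> < 1 / real (Suc i))" for i
    using Stone_Weierstrass_real_polynomial_function[of "sphere (0::complex) 1" \<phi> "1 / real (Suc i)"]
      \<phi> continuous_on_subset by (metis compact_sphere subset_UNIV of_nat_0_less_iff zero_less_Suc zero_less_divide_1_iff)
  then obtain p where *: "\<And>i. real_polynomial_function (p i) \<and>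
      (\<forall>z\<in>sphere 0 1. \<bar>\<phi> z - p i z\<bar> < 1 / real (Suc i))"
    by metis
  then have p: "real_polynomial_function (p i)" for i by blast
  have close: "\<bar>\<phi> z - p i z\<bar> < 1 / real (Suc i)" if "norm z = 1" for i z
    using *[of i] that by simp
  \<comment> \<open>The approximants stay within distance \<open>1\<close> of \<open>\<phi>\<close>, so a bound for \<open>\<phi>\<close> yields a dominating constant.\<close>
  have "compact (\<phi> ` sphere 0 1)"
    using \<phi> by (intro compact_continuous_image continuous_on_subset[OF \<phi>]) auto
  then obtain B where B: "\<And>z. norm z = 1 \<Longrightarrow> \<bar>\<phi> z\<bar> \<le> B"
    by (metis bounded_real compact_imp_bounded image_eqI mem_sphere_0)
  show ?thesis
  proof (rule annihilates_limit[OF m, where s="\<lambda>i x. of_real (p i (circle_exp x))" and w="\<lambda>_. B + 1"])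
    show "annihilates m (\<lambda>x. of_real (p i (circle_exp x)))" for i
      by (rule annihilates_polynomial[OF p m E])
    show "(\<lambda>i. complex_of_real (p i (circle_exp x))) \<longlonglongrightarrow> of_real (\<phi> (circle_exp x))" for x
    proof (intro tendsto_of_real)
      have "(\<lambda>i. p i (circle_exp x) - \<phi> (circle_exp x)) \<longlonglongrightarrow> 0"
      proof (rule Lim_null_comparison[OF _ LIMSEQ_Suc[OF lim_1_over_n]])
        show "\<forall>\<^sub>F i in sequentially. norm (p i (circle_exp x) - \<phi> (circle_exp x)) \<le> 1 / real (Suc i)"
          using close[of "circle_exp x"] by (intro always_eventually) (auto simp: abs_minus_commute less_imp_le)
      qed
      then show "(\<lambda>i. p i (circle_exp x)) \<longlonglongrightarrow> \<phi> (circle_exp x)" by (rule LIM_zero_cancel)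
    qed
    show "norm (complex_of_real (p i (circle_exp x))) \<le> B + 1" for i x
    proof -
      have "1 / real (Suc i) \<le> 1" by simp
      moreover have "\<bar>\<phi> (circle_exp x) - p i (circle_exp x)\<bar> < 1 / real (Suc i)" "\<bar>\<phi> (circle_exp x)\<bar> \<le> B"
        by (simp_all only: close B norm_circle_exp)
      ultimately have "\<bar>p i (circle_exp x)\<bar> \<le> B + 1" by linarith
      then show ?thesis by simp
    qed
  qed simp
qed

text \<open>The indicator of a closed set is the pointwise limit of the continuous functions
  \<open>max 0 (1 - i d(z, C))\<close>.\<close>

lemma annihilates_closed:
  assumes C: "closed C" and m: "m \<in> L1_dual"
    and E: "\<And>n. annihilates m (\<lambda>x. circle_exp x ^ n)" "\<And>n. annihilates m (\<lambda>x. cnj (circle_exp x) ^ n)"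
  shows "annihilates m (\<lambda>x. indicator C (circle_exp x))"
  \<comment> \<open>The distance to the empty set is \<open>0\<close> by convention, so this case is separate.\<close>
proof (cases "C = {}")
  case True
  then show ?thesis using annihilates_mult[OF m E(1), of 0] by simp
next
  case False
  let ?\<phi> = "\<lambda>i z. max 0 (1 - real i * infdist z C)"
  show ?thesis
  proof (rule annihilates_limit[OF m, where s="\<lambda>i x. of_real (?\<phi> i (circle_exp x))" and w="\<lambda>_. 1"])
    show "annihilates m (\<lambda>x. of_real (?\<phi> i (circle_exp x)))" for i
      by (rule annihilates_continuous[OF _ m E]) (intro continuous_intros)
    show "norm (complex_of_real (?\<phi> i (circle_exp x))) \<le> 1" for i x
      by (simp add: infdist_nonneg)
    show "(\<lambda>i. complex_of_real (?\<phi> i (circle_exp x))) \<longlonglongrightarrow> indicator C (circle_exp x)" for x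
    proof (cases "circle_exp x \<in> C")
      case True
      then show ?thesis by simp
    next
      case out: False
      then have d: "infdist (circle_exp x) C > 0"
        using C False in_closed_iff_infdist_zero infdist_nonneg by (metis less_eq_real_def)
      obtain N where N: "1 < real N * infdist (circle_exp x) C"
        using reals_Archimedean3[OF d] by blast
      have "?\<phi> i (circle_exp x) = 0" if "i \<ge> N" for i
        using N mult_right_mono[of "real N" "real i" "infdist (circle_exp x) C"] d that
        by (intro max_absorb1) linarith
      then have "\<forall>\<^sub>F i in sequentially. complex_of_real (?\<phi> i (circle_exp x)) = indicator C (circle_exp x)"
        using out by (auto simp: eventually_sequentially)
      then show ?thesis by (rule tendsto_eventually)
    qed
  qed simp
qed

text \<open>Closed sets form a \<open>\<pi>\<close>-system generating the Borel sets, and the sets whose indicator is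
  annihilated form a Dynkin system, the constant \<open>1 = E\<^sup>0\<close> being annihilated.\<close>

lemma annihilates_borel:
  assumes A: "A \<in> sets borel" and m: "m \<in> L1_dual"
    and E: "\<And>n. annihilates m (\<lambda>x. circle_exp x ^ n)" "\<And>n. annihilates m (\<lambda>x. cnj (circle_exp x) ^ n)"
  shows "annihilates m (\<lambda>x. indicator A (circle_exp x))"
proof -
  have "Int_stable (Collect closed)" "Collect closed \<subseteq> Pow (UNIV :: complex set)"
    by (auto simp: Int_stable_def)
  moreover have "A \<in> sigma_sets UNIV (Collect closed)"
    using A by (simp add: borel_eq_closed)
  ultimately show ?thesis
  proof (induction rule: sigma_sets_induct_disjoint)
    case (basic A)
    then show ?case using annihilates_closed[OF _ m E] by simp
  next
    case empty
    then show ?case using annihilates_closed[OF _ m E, of "{}"] by simp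
  next
    case (compl A)
    have "annihilates m (\<lambda>x. circle_exp x ^ 0 + (- 1) * indicator A (circle_exp x))"
      by (intro annihilates_add annihilates_mult m E compl)
    then show ?case by (simp add: indicator_diff)
  next
    case (union A)
    show ?case
    proof (rule annihilates_limit[OF m, where s="\<lambda>k x. \<Sum>i<k. indicator (A i) (circle_exp x)" and w="\<lambda>_. 1"])
      show "annihilates m (\<lambda>x. \<Sum>i<k. indicator (A i) (circle_exp x))" for k
        by (intro annihilates_sum m union)
      have eq: "(\<Sum>i<k. indicator (A i) z :: complex) = indicator (\<Union>i<k. A i) z" for k z
        using union(1) by (subst indicator_UN_disjoint) (auto intro: disjoint_family_on_mono)
      show "norm (\<Sum>i<k. indicator (A i) (circle_exp x) :: complex) \<le> 1" for k x
        unfolding eq by (simp add: indicator_def)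
      show "(\<lambda>k. \<Sum>i<k. indicator (A i) (circle_exp x) :: complex) \<longlonglongrightarrow> indicator (\<Union>i. A i) (circle_exp x)" for x
        unfolding eq by (rule LIMSEQ_indicator_UN)
    qed simp
  qed
qed

text \<open>Density of the trigonometric polynomials in \<open>L\<^sup>1\<close>, in dual form: from indicators one
  reaches all integrable functions by linearity and dominated convergence.\<close>

lemma trig_monomials_total:
  assumes m: "m \<in> L1_dual"
    and E: "\<And>n. annihilates m (\<lambda>x. circle_exp x ^ n)" "\<And>n. annihilates m (\<lambda>x. cnj (circle_exp x) ^ n)"
  shows "m u = 0"
proof -
  obtain f where f: "integrable haar f" "u = abs_L1_circle f" by (rule L1_circle_cases)
  from f(1) have "annihilates m f"
  proof (induction rule: integrable_induct)
    case (base A c)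
    obtain \<sigma> where [measurable]: "\<sigma> \<in> borel_measurable borel" and \<sigma>: "\<And>x. \<sigma> (circle_exp x) = x"
      using circle_exp_section by blast
    from base have "\<sigma> -` A \<in> sets borel"
      using measurable_sets[of \<sigma> borel borel A] by simp
    then have "annihilates m (\<lambda>x. c * indicator (\<sigma> -` A) (circle_exp x))"
      by (intro annihilates_mult annihilates_borel m E)
    moreover have "c * indicator (\<sigma> -` A) (circle_exp x) = indicat_real A x *\<^sub>R c" for x
      by (simp add: indicator_def \<sigma>)
    ultimately show ?case by simp
  next
    case (add f g)
    then show ?case by (intro annihilates_add m)
  next
    case (lim f s)
    then show ?case
      by (intro annihilates_limit[OF m, of s f "\<lambda>x. 2 * norm (f x)"]) auto
  qed
  with f show ?thesis by (simp add: annihilates_def)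
qed

section \<open>The cosine coefficients\<close>

definition cosine_wave :: "nat \<Rightarrow> circle \<Rightarrow> complex" where
  "cosine_wave n x = (circle_exp x ^ n + cnj (circle_exp x) ^ n) / 2"

text \<open>The functional equation of the cosine: \<open>cosine_wave n\<close> plays for the cosine convolution the
  role that group characters play for the ordinary one.\<close>

lemma cosine_wave_addition:
  "(cosine_wave n (x + y) + cosine_wave n (x - y)) / 2 = cosine_wave n x * cosine_wave n y"
  by (simp add: cosine_wave_def circle_exp_minus circle_exp_add diff_conv_add_uminus power_mult_distrib field_simps
      del: add_uminus_conv_diff)

lemma norm_cosine_wave: "norm (cosine_wave n x) \<le> 1"
proof -
  have "norm (circle_exp x ^ n + cnj (circle_exp x) ^ n) \<le> 1 + 1"
    by (rule order_trans[OF norm_triangle_ineq]) (simp add: norm_power)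
  then show ?thesis by (simp add: cosine_wave_def norm_divide)
qed

lemma measurable_cosine_wave [measurable]: "cosine_wave n \<in> borel_measurable borel"
  unfolding cosine_wave_def[abs_def] by measurable

lemma integrable_cosine_wave: "integrable haar (cosine_wave n)"
  by (rule integrable_bounded_haar[OF measurable_cosine_wave norm_cosine_wave])

lemma integrable_mult_cosine_wave:
  assumes "integrable M f" "s \<in> borel_measurable M"
  shows "integrable M (\<lambda>x. f x * cosine_wave n (s x))"
proof (rule Bochner_Integration.integrable_bound[OF assms(1)])
  show "(\<lambda>x. f x * cosine_wave n (s x)) \<in> borel_measurable M"
    using assms by measurable
  show "AE x in M. norm (f x * cosine_wave n (s x)) \<le> norm (f x)"
    by (intro AE_I2) (simp add: norm_mult mult_left_le norm_cosine_wave)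
qed

lift_definition cosine_coeff :: "nat \<Rightarrow> L1_circle \<Rightarrow> complex"
  is "\<lambda>n f. \<integral>x. f x * cosine_wave n x \<partial>haar"
proof -
  fix n and f g :: "circle \<Rightarrow> complex"
  assume *: "integrable haar f \<and> integrable haar g \<and> (AE x in haar. f x = g x)"
  then have [measurable]: "f \<in> borel_measurable borel" "g \<in> borel_measurable borel"
    by (auto dest: borel_measurable_integrable)
  from * show "(\<integral>x. f x * cosine_wave n x \<partial>haar) = (\<integral>x. g x * cosine_wave n x \<partial>haar)"
    by (intro integral_cong_AE) auto
qed

lemma cosine_coeff_abs_L1_circle:
  "integrable haar f \<Longrightarrow> cosine_coeff n (abs_L1_circle f) = (\<integral>x. f x * cosine_wave n x \<partial>haar)"
  by (simp add: cosine_coeff.abs_eq)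

lemma cosine_coeff_add: "cosine_coeff n (u + v) = cosine_coeff n u + cosine_coeff n v"
  by transfer (simp add: integrable_mult_cosine_wave[where s="\<lambda>x. x"] distrib_right)

lemma cosine_coeff_cscale: "cosine_coeff n (cscale c u) = c * cosine_coeff n u"
  by transfer (simp add: mult.assoc)

lemma norm_cosine_coeff: "norm (cosine_coeff n u) \<le> norm u"
proof transfer
  fix n and f :: "circle \<Rightarrow> complex"
  assume "integrable haar f \<and> integrable haar f \<and> (AE x in haar. f x = f x)"
  then have f: "integrable haar f" by simp
  then have "(\<integral>x. norm (f x * cosine_wave n x) \<partial>haar) \<le> (\<integral>x. norm (f x) \<partial>haar)"
    by (intro integral_mono integrable_norm integrable_mult_cosine_wave)
       (auto simp: norm_mult mult_left_le norm_cosine_wave)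
  with integral_norm_bound[of haar "\<lambda>x. f x * cosine_wave n x"]
  show "norm (\<integral>x. f x * cosine_wave n x \<partial>haar) \<le> (\<integral>x. norm (f x) \<partial>haar)" by linarith
qed

lemma cosine_coeff_in_dual: "cosine_coeff n \<in> L1_dual"
proof -
  have "Vector_Spaces.linear cscale (*) (cosine_coeff n)"
    unfolding Vector_Spaces.linear_iff
    using vector_space_cscale vector_space_over_itself.vector_space_axioms
    by (auto simp: cosine_coeff_add cosine_coeff_cscale)
  moreover have "bounded_linear (cosine_coeff n)"
  proof (rule bounded_linear_intro[where K=1])
    show "cosine_coeff n (r *\<^sub>R u) = r *\<^sub>R cosine_coeff n u" for r u
      by (simp add: cosine_coeff_cscale scaleR_conv_of_real flip: cscale_of_real)
  qed (simp_all add: cosine_coeff_add norm_cosine_coeff)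
  ultimately show ?thesis
    by (simp add: L1_dual_def linear_continuous_on)
qed

lemma integral_translate_cosine_wave:
  assumes "integrable haar g"
  shows "(\<integral>x. g (x + a) * cosine_wave n x \<partial>haar) = (\<integral>x. g x * cosine_wave n (x - a) \<partial>haar)"
proof -
  have [measurable]: "g \<in> borel_measurable borel"
    using assms by (auto dest: borel_measurable_integrable)
  have "(\<lambda>x. g x * cosine_wave n (x - a)) \<in> borel_measurable borel" by measurable
  from integral_haar_translate[OF this, of a] show ?thesis by simp
qed

text \<open>Integrate first over \<open>x\<close>. Translation invariance moves the shifts by \<open>y\<close> and \<open>-y\<close> from \<open>g\<close> to
  the cosine wave, where the addition formula splits off the factor \<open>cosine_wave n y\<close>.\<close>

lemma cosine_coeff_cosine_conv:
  "cosine_coeff n (u \<star>\<^sub>c v) = cosine_coeff n u * cosine_coeff n v"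
proof -
  obtain f where f: "integrable haar f" "u = abs_L1_circle f" by (rule L1_circle_cases)
  obtain g where g: "integrable haar g" "v = abs_L1_circle g" by (rule L1_circle_cases)
  let ?k = "\<lambda>x y. f y * ((g (x + y) + g (x - y)) / 2)"
  let ?c = "\<integral>x. g x * cosine_wave n x \<partial>haar"
  have int: "integrable (haar \<Otimes>\<^sub>M haar) (\<lambda>(x, y). ?k x y)"
    by (rule integrable_pair_cosine[OF f(1) g(1)])
  have "integrable (haar \<Otimes>\<^sub>M haar) (\<lambda>p. (case p of (x, y) \<Rightarrow> ?k x y) * cosine_wave n (fst p))"
    by (rule integrable_mult_cosine_wave[OF int]) measurable
  then have int2: "integrable (haar \<Otimes>\<^sub>M haar) (\<lambda>(x, y). ?k x y * cosine_wave n x)"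
    by (simp add: case_prod_unfold)
  have inner: "(\<integral>x. ?k x y * cosine_wave n x \<partial>haar) = f y * cosine_wave n y * ?c" for y
  proof -
    have i: "integrable haar (\<lambda>x. g (x + a) * cosine_wave n x)" 
        "integrable haar (\<lambda>x. g x * cosine_wave n (x + a))" for a
      by (intro integrable_mult_cosine_wave integrable_haar_translate g(1); measurable)+
    have "(\<integral>x. ?k x y * cosine_wave n x \<partial>haar) =
       (\<integral>x. f y / 2 * (g (x + y) * cosine_wave n x + g (x + - y) * cosine_wave n x) \<partial>haar)"
      by (simp add: field_simps)
    also have "\<dots> = f y / 2 * ((\<integral>x. g (x + y) * cosine_wave n x \<partial>haar) + (\<integral>x. g (x + - y) * cosine_wave n x \<partial>haar))"
      by (simp only: integral_mult_right_zero Bochner_Integration.integral_add[OF i(1) i(1)])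
    also have "\<dots> = f y / 2 * ((\<integral>x. g x * cosine_wave n (x + - y) \<partial>haar) + (\<integral>x. g x * cosine_wave n (x + y) \<partial>haar))"
      using integral_translate_cosine_wave[OF g(1), of y n] integral_translate_cosine_wave[OF g(1), of "-y" n] by simp
    also have "\<dots> = f y / 2 * (\<integral>x. g x * cosine_wave n (x + - y) + g x * cosine_wave n (x + y) \<partial>haar)"
      by (simp only: Bochner_Integration.integral_add[OF i(2) i(2)])
    also have "(\<lambda>x. g x * cosine_wave n (x + - y) + g x * cosine_wave n (x + y))
        = (\<lambda>x. 2 * cosine_wave n y * (g x * cosine_wave n x))"
    proof
      fix x
      have "cosine_wave n (x + y) + cosine_wave n (x - y) = 2 * (cosine_wave n x * cosine_wave n y)"
        using cosine_wave_addition[of n x y] by (simp add: field_simps)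
      then have "g x * (cosine_wave n (x + y) + cosine_wave n (x - y)) = g x * (2 * (cosine_wave n x * cosine_wave n y))"
        by simp
      then show "g x * cosine_wave n (x + - y) + g x * cosine_wave n (x + y) = 2 * cosine_wave n y * (g x * cosine_wave n x)"
        by (simp add: algebra_simps)
    qed
    finally show ?thesis by simp
  qed
  have "cosine_coeff n (u \<star>\<^sub>c v) = (\<integral>x. (\<integral>y. ?k x y \<partial>haar) * cosine_wave n x \<partial>haar)"
    using haar_pair.integrable_fst'[OF int]
    by (simp add: f g cosine_conv_abs_L1_circle cosine_coeff_abs_L1_circle)
  also have "\<dots> = (\<integral>x. (\<integral>y. ?k x y * cosine_wave n x \<partial>haar) \<partial>haar)"
    by (simp only: integral_mult_left_zero)
  also have "\<dots> = (\<integral>y. (\<integral>x. ?k x y * cosine_wave n x \<partial>haar) \<partial>haar)"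
    by (rule haar_pair.Fubini_integral[OF int2, symmetric])
  also have "\<dots> = (\<integral>y. f y * cosine_wave n y \<partial>haar) * ?c"
    by (simp only: inner integral_mult_left_zero)
  finally show ?thesis by (simp add: f g cosine_coeff_abs_L1_circle)
qed

text \<open>The cosine waves are eigenvectors of all convolution operators \<open>v \<mapsto> u \<star>\<^sub>c v\<close>; this is what
  forces a character not vanishing on one of them to be a cosine coefficient.\<close>

lemma cosine_conv_cosine_wave:
  "u \<star>\<^sub>c abs_L1_circle (cosine_wave n) = cscale (cosine_coeff n u) (abs_L1_circle (cosine_wave n))"
proof -
  obtain f where f: "integrable haar f" "u = abs_L1_circle f" by (rule L1_circle_cases)
  have "(\<integral>y. f y * ((cosine_wave n (x + y) + cosine_wave n (x - y)) / 2) \<partial>haar)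
      = cosine_coeff n u * cosine_wave n x" for x
  proof -
    have "(\<integral>y. f y * (cosine_wave n x * cosine_wave n y) \<partial>haar) = (\<integral>y. cosine_wave n x * (f y * cosine_wave n y) \<partial>haar)"
      by (simp add: algebra_simps)
    then show ?thesis
      by (simp add: cosine_wave_addition f cosine_coeff_abs_L1_circle)
  qed
  then show ?thesis
    using f by (simp add: cosine_conv_abs_L1_circle integrable_cosine_wave cscale_abs_L1_circle)
qed

text \<open>The kernel \<open>(g(x + y) + g(x - y))/2\<close> is even in \<open>y\<close>, so the convolution only sees the even
  part of its left factor.\<close>

lemma cosine_conv_odd:
  assumes f: "integrable haar f" and odd: "\<And>x. f (- x) = - f x"
  shows "abs_L1_circle f \<star>\<^sub>c v = 0"
proof -
  obtain g where g: "integrable haar g" "v = abs_L1_circle g" by (rule L1_circle_cases)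
  have [measurable]: "f \<in> borel_measurable borel" "g \<in> borel_measurable borel"
    using f g by (auto dest: borel_measurable_integrable)
  have "(\<integral>y. f y * ((g (x + y) + g (x - y)) / 2) \<partial>haar) = 0" for x
  proof -
    let ?F = "\<lambda>y. f y * ((g (x + y) + g (x - y)) / 2)"
    have "(\<integral>y. ?F y \<partial>haar) = (\<integral>y. ?F y \<partial>distr haar borel uminus)" by (simp add: haar_uminus)
    also have "\<dots> = (\<integral>y. ?F (- y) \<partial>haar)" by (rule integral_distr) measurable
    also have "\<dots> = (\<integral>y. - ?F y \<partial>haar)" by (simp add: odd add.commute)
    finally show ?thesis by simp
  qed
  then show ?thesis
    using f g by (simp add: cosine_conv_abs_L1_circle zero_L1_circle_def)
qed

section \<open>Characters\<close>

lemma integral_cosine_wave: "(\<integral>x. cosine_wave n x \<partial>haar) = (if n = 0 then 1 else 0)"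
proof (cases "n = 0")
  case True
  then show ?thesis by (simp add: cosine_wave_def measure_def)
next
  case False
  \<comment> \<open>Translation by half a period changes the sign of the wave but not its integral.\<close>
  define a where "a = abs_circle (1 / (2 * real n))"
  have "circle_exp a ^ n = -1"
    using False by (simp add: a_def circle_exp.abs_eq Complex.DeMoivre)
  then have "cosine_wave n (x + a) = - cosine_wave n x" for x
    by (simp add: cosine_wave_def circle_exp_add power_mult_distrib field_simps flip: complex_cnj_power)
  then have "(\<integral>x. cosine_wave n x \<partial>haar) = - (\<integral>x. cosine_wave n x \<partial>haar)"
    using integral_haar_translate[OF measurable_cosine_wave, of n a] by simp
  with False show ?thesis by simp
qed

lemma cosine_wave_mult:
  assumes "k \<le> n"
  shows "cosine_wave n x * cosine_wave k x = (cosine_wave (n + k) x + cosine_wave (n - k) x) / 2"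
proof -
  let ?z = "circle_exp x"
  have "?z ^ n * cnj ?z ^ k = ?z ^ (n - k)" "cnj ?z ^ n * ?z ^ k = cnj ?z ^ (n - k)"
    using circle_exp_power_cancel[OF assms] by simp_all
  then show ?thesis
    by (simp add: cosine_wave_def power_add field_simps)
qed

lemma cosine_coeff_cosine_wave_eq_0_iff:
  "cosine_coeff n (abs_L1_circle (cosine_wave k)) = 0 \<longleftrightarrow> n \<noteq> k"
proof -
  have main: "(\<integral>x. cosine_wave n x * cosine_wave k x \<partial>haar) = 0 \<longleftrightarrow> n \<noteq> k" if "k \<le> n" for n k
    using that by (auto simp: cosine_wave_mult integrable_cosine_wave integral_cosine_wave)
  show ?thesis
    using main[of k n] main[of n k]
    by (cases "k \<le> n") (auto simp: cosine_coeff_abs_L1_circle integrable_cosine_wave mult.commute)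
qed

lemma character_eq_cosine_coeff:
  assumes m: "m \<in> structure_space" and n: "m (abs_L1_circle (cosine_wave n)) \<noteq> 0"
  shows "m = cosine_coeff n"
proof
  fix u
  have d: "m \<in> L1_dual" and mult: "\<And>u v. m (u \<star>\<^sub>c v) = m u * m v"
    using m by (auto simp: structure_space_def)
  have "m u * m (abs_L1_circle (cosine_wave n)) = m (u \<star>\<^sub>c abs_L1_circle (cosine_wave n))"
    by (simp add: mult)
  also have "\<dots> = cosine_coeff n u * m (abs_L1_circle (cosine_wave n))"
    by (simp add: cosine_conv_cosine_wave L1_dual_cscale[OF d])
  finally show "m u = cosine_coeff n u" using n by simp
qed

lemma character_odd:
  assumes m: "m \<in> structure_space" and f: "integrable haar f" "\<And>x. f (- x) = - f x"
  shows "annihilates m f"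
proof -
  have d: "m \<in> L1_dual" and mult: "\<And>u v. m (u \<star>\<^sub>c v) = m u * m v" and "\<exists>v. m v \<noteq> 0"
    using m by (auto simp: structure_space_def)
  then obtain v where v: "m v \<noteq> 0" by blast
  have "m (abs_L1_circle f) * m v = m 0"
    using cosine_conv_odd[OF f, of v] by (simp flip: mult)
  also have "m 0 = 0" using L1_dual_add[OF d, of 0 0] by simp
  finally show ?thesis using v f by (simp add: annihilates_def)
qed

text \<open>Otherwise the character would vanish on \<open>E\<^sup>n = c\<^sub>n + s\<^sub>n\<close> and \<open>E\<^sup>-\<^sup>n = c\<^sub>n - s\<^sub>n\<close>, where
  \<open>s\<^sub>n = (E\<^sup>n - E\<^sup>-\<^sup>n)/2\<close> is odd, and hence everywhere.\<close>

lemma character_cosine_wave_nonzero: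
  assumes m: "m \<in> structure_space"
  obtains n where "m (abs_L1_circle (cosine_wave n)) \<noteq> 0"
proof (rule ccontr)
  assume "\<not> thesis"
  then have c: "annihilates m (cosine_wave n)" for n
    using that by (auto simp: annihilates_def integrable_cosine_wave)
  have d: "m \<in> L1_dual" using m by (simp add: structure_space_def)
  let ?s = "\<lambda>n x. circle_exp x ^ n + (-1) * cnj (circle_exp x) ^ n"
  have s: "annihilates m (?s n)" for n
  proof (rule character_odd[OF m])
    show "integrable haar (?s n)"
    proof (rule integrable_bounded_haar)
      show "norm (?s n x) \<le> 2" for x
        by (rule order_trans[OF norm_triangle_ineq]) (simp add: norm_power)
    qed measurable
  qed (simp add: circle_exp_minus)
  have "annihilates m (\<lambda>x. cosine_wave n x + 1/2 * ?s n x)"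
       "annihilates m (\<lambda>x. cosine_wave n x + (-1/2) * ?s n x)" for n
    by (intro annihilates_add annihilates_mult d c s)+
  then have "annihilates m (\<lambda>x. circle_exp x ^ n)" "annihilates m (\<lambda>x. cnj (circle_exp x) ^ n)" for n
    by (simp_all add: cosine_wave_def field_simps)
  then have "m u = 0" for u
    by (rule trig_monomials_total[OF d])
  then have "m = (\<lambda>_. 0)" by blast
  with m show False by (simp add: structure_space_def)
qed

lemma cosine_coeff_in_structure_space: "cosine_coeff n \<in> structure_space"
  using cosine_coeff_cosine_wave_eq_0_iff[of n n]
  by (auto simp: structure_space_def cosine_coeff_in_dual cosine_coeff_cosine_conv)

lemma structure_space_eq: "structure_space = range cosine_coeff"
proof
  show "structure_space \<subseteq> range cosine_coeff"
    using character_cosine_wave_nonzero character_eq_cosine_coeff by (metis rangeI subsetI)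
  show "range cosine_coeff \<subseteq> structure_space"
    using cosine_coeff_in_structure_space by blast
qed

text \<open>A character \<open>m\<close> is isolated by the weak* open condition that the value at \<open>cosine_wave n\<close> be
  nonzero, for any \<open>n\<close> with \<open>m\<close> nonzero there: that condition determines the character.\<close>

lemma subtopology_structure_space:
  "subtopology weak_star structure_space = discrete_topology structure_space"
proof -
  have sub: "structure_space \<subseteq> L1_dual" by (auto simp: structure_space_def)
  have "openin (subtopology weak_star structure_space) {m}" if m: "m \<in> structure_space" for m
  proof -
    obtain n where n: "m (abs_L1_circle (cosine_wave n)) \<noteq> 0"
      using character_cosine_wave_nonzero[OF m] .
    let ?U = "{m \<in> L1_dual. m (abs_L1_circle (cosine_wave n)) \<in> - {0}}"
    have "openin weak_star ?U"
      unfolding weak_star_def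
      by (rule topology_generated_by_Basis) (blast intro: open_Compl closed_singleton)
    moreover have "{m} = ?U \<inter> structure_space"
      using m n sub by (auto dest: character_eq_cosine_coeff[of _ n])
    ultimately show ?thesis unfolding openin_subtopology by blast
  qed
  then show ?thesis
    using sub by (intro discrete_topology_unique[THEN iffD2, symmetric]) (auto simp: topspace_subtopology)
qed

theorem theorem13:
  shows "subtopology weak_star structure_space homeomorphic_space discrete_topology (UNIV :: nat set)"
proof -
  have inj: "inj cosine_coeff"
    using cosine_coeff_cosine_wave_eq_0_iff by (metis injI)
  have "homeomorphic_maps (discrete_topology (UNIV :: nat set)) (discrete_topology structure_space)
      cosine_coeff (inv cosine_coeff)"
    using inj by (auto simp: homeomorphic_maps_def structure_space_eq)
  then show ?thesis
    unfolding subtopology_structure_space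
    using homeomorphic_space_def homeomorphic_space_sym by blast
qed

end
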